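(* For each graph $G$, $\mathrm{Fall}(M(G))=\emptyset$, where $M(G)$ is the Mycielskian of $G$.
   Context: All graphs are finite, simple (undirected, no loops, no multiple edges), with nonempty vertex set. For $k\in\mathbb{N}=\{1,2,\dots\}$ let $[k]=\{1,\dots,k\}$. A (proper) $k$-coloring of a graph $G$ is a function $f:V(G)\to[k]$ such that each $f^{-1}(i)$ is an independent set. It is a fall $k$-coloring if $f(N[v])=[k]$ for every $v\in V(G)$, where $N[v]$ is the closed neighborhood of $v$. $\mathrm{Fall}(G)$ is the set of all positive integers $k$ such that $G$ has a fall $k$-coloring. For a graph $G$ with $V(G)=\{x_1,\dots,x_n\}$, the Mycielskian $M(G)$ is the graph with the $2n+1$ vertices $x_1,\dots,x_n,y_1,\dots,y_n,z$ and edge set $E(G)\cup\{\{y_i,x_j\} : i,j\in[n],\ \{x_i,x_j\}\in E(G)\}\cup\{\{z,y_i\} : i\in[n]\}$. *)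

theory Defs
  imports "Graph_Theory.Pair_Digraph"
begin

text \<open>
  Finite simple graphs are the graphs of locale \<^locale>\<open>pair_graph\<close>: an undirected edge
  \<open>{u, v}\<close> is represented by the two arcs \<open>(u, v)\<close> and \<open>(v, u)\<close>. That locale admits the
  graph without vertices.
\<close>

definition independent_set :: "'a pair_pre_digraph \<Rightarrow> 'a set \<Rightarrow> bool" where
  "independent_set G S \<longleftrightarrow> S \<subseteq> pverts G \<and> (\<forall>u\<in>S. \<forall>v\<in>S. (u, v) \<notin> parcs G)"

definition closed_nbhd :: "'a pair_pre_digraph \<Rightarrow> 'a \<Rightarrow> 'a set" where
  "closed_nbhd G v = insert v {u \<in> pverts G. (v, u) \<in> parcs G}"

text \<open>Only the values of a coloring on the vertex set matter.\<close>

definition proper_coloring :: "'a pair_pre_digraph \<Rightarrow> nat \<Rightarrow> ('a \<Rightarrow> nat) \<Rightarrow> bool" where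
  "proper_coloring G k f \<longleftrightarrow>
     f ` pverts G \<subseteq> {1..k} \<and> (\<forall>i\<in>{1..k}. independent_set G {v \<in> pverts G. f v = i})"

definition fall_coloring :: "'a pair_pre_digraph \<Rightarrow> nat \<Rightarrow> ('a \<Rightarrow> nat) \<Rightarrow> bool" where
  "fall_coloring G k f \<longleftrightarrow>
     proper_coloring G k f \<and> (\<forall>v\<in>pverts G. f ` closed_nbhd G v = {1..k})"

definition Fall :: "'a pair_pre_digraph \<Rightarrow> nat set" where
  "Fall G = {k. k \<ge> 1 \<and> (\<exists>f. fall_coloring G k f)}"

text \<open>\<open>Orig x\<^sub>i\<close>, \<open>Copy x\<^sub>i\<close> and \<open>Apex\<close> are the vertices \<open>x\<^sub>i\<close>, \<open>y\<^sub>i\<close> and \<open>z\<close> of the Mycielskian.\<close>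

datatype 'a myc_vertex = Orig 'a | Copy 'a | Apex

definition mycielskian :: "'a pair_pre_digraph \<Rightarrow> 'a myc_vertex pair_pre_digraph" where
  "mycielskian G =
     \<lparr> pverts = Orig ` pverts G \<union> Copy ` pverts G \<union> {Apex},
       parcs = {(Orig u, Orig v) | u v. (u, v) \<in> parcs G}
             \<union> {(Copy u, Orig v) | u v. (u, v) \<in> parcs G}
             \<union> {(Orig u, Copy v) | u v. (u, v) \<in> parcs G}
             \<union> {(Apex, Copy u) | u. u \<in> pverts G}
             \<union> {(Copy u, Apex) | u. u \<in> pverts G} \<rparr>"

lemma pair_graph_mycielskian:
  assumes "pair_graph G"
  shows "pair_graph (mycielskian G)"
proof -
  interpret pair_graph G by fact
  let ?M = "mycielskian G"
  have wf: "fst e \<in> pverts ?M" "snd e \<in> pverts ?M" if "e \<in> parcs ?M" for e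
    using that by (auto simp: mycielskian_def dest: in_arcsD1 in_arcsD2)
  have fin: "finite (pverts ?M)"
    by (simp add: mycielskian_def pair_finite_verts)
  moreover have "parcs ?M \<subseteq> pverts ?M \<times> pverts ?M"
    using wf by (auto simp: mem_Times_iff)
  ultimately have "finite (parcs ?M)"
    by (meson finite_SigmaI finite_subset)
  moreover have "sym (parcs G)"
    using pair_sym_arcs by (simp add: symmetric_def)
  then have "sym (parcs ?M)"
    by (auto simp: mycielskian_def sym_def)
  moreover have "fst e \<noteq> snd e" if "e \<in> parcs ?M" for e
    using that pair_no_loops by (auto simp: mycielskian_def)
  ultimately show ?thesis
    using wf fin by unfold_locales (auto simp: symmetric_def)
qed

lemma card_pverts_mycielskian:
  assumes "finite (pverts G)"
  shows "card (pverts (mycielskian G)) = 2 * card (pverts G) + 1"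
proof -
  have "card (Orig ` pverts G \<union> Copy ` pverts G) = 2 * card (pverts G)"
    using assms by (subst card_Un_disjoint) (auto simp: card_image inj_on_def)
  then show ?thesis
    using assms by (simp add: mycielskian_def image_iff)
qed

end

theory Submission
  imports Defs
begin

text \<open>
  Let \<open>f\<close> be a fall coloring of \<open>M(G)\<close> and \<open>c = f(z)\<close>; no \<open>y\<^sub>i\<close> has color \<open>c\<close>. The
  neighbors of \<open>y\<^sub>i\<close> are \<open>z\<close> and the neighbors of \<open>x\<^sub>i\<close> in \<open>G\<close>, so the color of \<open>x\<^sub>i\<close>,
  which \<open>y\<^sub>i\<close> must see, is \<open>c\<close> or \<open>f(y\<^sub>i)\<close>. If \<open>f(x\<^sub>i) = c\<close>, then \<open>x\<^sub>i\<close> sees the color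
  \<open>f(y\<^sub>i)\<close> at some \<open>x\<^sub>j\<close> or \<open>y\<^sub>j\<close> with \<open>x\<^sub>j\<close> adjacent to \<open>x\<^sub>i\<close>; as \<open>f(x\<^sub>j) \<noteq> c\<close>, in both
  cases \<open>f(x\<^sub>j) = f(y\<^sub>i)\<close>, although \<open>x\<^sub>j\<close> and \<open>y\<^sub>i\<close> are adjacent. Hence the color \<open>c\<close> occurs
  only at \<open>z\<close>, and \<open>x\<^sub>i\<close> does not see it.
\<close>

lemma proper_coloring_adjacent:
  assumes "proper_coloring G k f" "(u, v) \<in> parcs G" "u \<in> pverts G" "v \<in> pverts G"
  shows "f u \<noteq> f v"
proof
  assume "f u = f v"
  moreover have "f u \<in> {1..k}"
    using assms by (auto simp: proper_coloring_def)
  ultimately show False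
    using assms unfolding proper_coloring_def independent_set_def by fastforce
qed

text \<open>Naming the color by a vertex \<open>w\<close> that bears it settles membership in
  \<open>{1..k}\<close> here, once and for all.\<close>

lemma fall_coloring_sees_color:
  assumes "fall_coloring G k f" "v \<in> pverts G" "w \<in> pverts G"
  obtains u where "f u = f w" "u = v \<or> u \<in> pverts G \<and> (v, u) \<in> parcs G"
proof -
  have "f w \<in> f ` closed_nbhd G v"
    using assms by (auto simp: fall_coloring_def proper_coloring_def)
  then show thesis
    using that by (auto simp: closed_nbhd_def)
qed

lemma no_fall_coloring_mycielskian:
  assumes "pverts G \<noteq> {}"
  shows "\<not> fall_coloring (mycielskian G) k f"
proof
  let ?M = "mycielskian G"
  assume fall: "fall_coloring ?M k f"
  have proper: "f u \<noteq> f v" if "(u, v) \<in> parcs ?M" "u \<in> pverts ?M" "v \<in> pverts ?M" for u v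
    using that fall proper_coloring_adjacent unfolding fall_coloring_def by metis
  have copy_Apex: "f (Copy x) \<noteq> f Apex" if "x \<in> pverts G" for x
    using that by (intro proper) (auto simp: mycielskian_def)
  have orig_orig: "f (Orig x) \<noteq> f (Orig y)"
    and copy_orig: "f (Copy x) \<noteq> f (Orig y)"
    if "(x, y) \<in> parcs G" "x \<in> pverts G" "y \<in> pverts G" for x y
    using that by (intro proper; simp add: mycielskian_def)+
  have orig_color: "f (Orig x) = f Apex \<or> f (Orig x) = f (Copy x)" if x: "x \<in> pverts G" for x
  proof -
    obtain u where "f u = f (Orig x)" "u = Copy x \<or> u \<in> pverts ?M \<and> (Copy x, u) \<in> parcs ?M"
      using fall by (rule fall_coloring_sees_color[of _ _ _ "Copy x" "Orig x"])
        (use x in \<open>auto simp: mycielskian_def\<close>)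
    \<comment> \<open>\<open>u = Apex\<close> and \<open>u = Copy x\<close> give the two
      alternatives; \<open>orig_orig\<close> excludes the remaining case
      \<open>u = Orig y\<close>.\<close>
    then show ?thesis
      using orig_orig x by (fastforce simp: mycielskian_def)
  qed
  have orig_Apex: "f (Orig x) \<noteq> f Apex" if x: "x \<in> pverts G" for x
  proof
    assume c: "f (Orig x) = f Apex"
    obtain u where u: "f u = f (Copy x)" "u = Orig x \<or> u \<in> pverts ?M \<and> (Orig x, u) \<in> parcs ?M"
      using fall by (rule fall_coloring_sees_color[of _ _ _ "Orig x" "Copy x"])
        (use x in \<open>auto simp: mycielskian_def\<close>)
    \<comment> \<open>\<open>u = Orig x\<close> is impossible, since
      \<open>f (Orig x) = f Apex\<close> differs from \<open>f (Copy x)\<close>.\<close>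
    then obtain y where y: "(x, y) \<in> parcs G" "y \<in> pverts G" "u = Orig y \<or> u = Copy y"
      using c copy_Apex[OF x] by (auto simp: mycielskian_def)
    then have "f (Orig y) \<noteq> f Apex"
      using orig_orig x c by metis
    \<comment> \<open>If \<open>u = Copy y\<close>, then \<open>orig_color\<close> at
      \<open>y\<close> leaves only \<open>f (Orig y) = f (Copy y)\<close>.\<close>
    then have "f (Orig y) = f (Copy x)"
      using orig_color u y by metis
    then show False
      using copy_orig x y by metis
  qed
  obtain x where x: "x \<in> pverts G"
    using assms by blast
  obtain u where "f u = f Apex" "u = Orig x \<or> u \<in> pverts ?M \<and> (Orig x, u) \<in> parcs ?M"
    using fall by (rule fall_coloring_sees_color[of _ _ _ "Orig x" Apex])
      (use x in \<open>auto simp: mycielskian_def\<close>)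
  then show False
    using x copy_Apex orig_Apex by (auto simp: mycielskian_def)
qed

theorem theorem11:
  fixes G :: "'a pair_pre_digraph"
  assumes "pair_graph G" and "pverts G \<noteq> {}"
  shows "Fall (mycielskian G) = {}"
  using no_fall_coloring_mycielskian[OF assms(2)] by (simp add: Fall_def)

end
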